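(* Let $\mathbb{E}^2$ be the real plane with the Euclidean norm. Then $SS(\mathbb{E}^2) = \sqrt{3}$.
   Context: For a finite-dimensional real normed space $L$ with unit ball $B = \{x \in L : \|x\| \leq 1\}$, the sign-sequence constant $SS(L)$ is the least $t > 0$ such that, for each finite sequence $v_1, \ldots, v_n \in B$ (of any length $n$), there are signs $\varepsilon_1, \ldots, \varepsilon_n \in \{-1, +1\}$ such that $\varepsilon_1 v_1 + \ldots + \varepsilon_k v_k \in tB$ for each $1 \leq k \leq n$. *)

theory Defs
  imports "HOL-Analysis.Analysis"
begin

definition sign_sequence_bound :: "'a::real_normed_vector itself \<Rightarrow> real \<Rightarrow> bool" where
  "sign_sequence_bound L t \<longleftrightarrow>
     (\<forall>(n::nat) (v :: nat \<Rightarrow> 'a). (\<forall>i\<in>{1..n}. v i \<in> cball 0 1) \<longrightarrow>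
        (\<exists>\<epsilon> :: nat \<Rightarrow> real. (\<forall>i\<in>{1..n}. \<epsilon> i \<in> {-1, 1}) \<and>
           (\<forall>k\<in>{1..n}. (\<Sum>i=1..k. \<epsilon> i *\<^sub>R v i) \<in> (*\<^sub>R) t ` cball 0 1)))"

text \<open>The space is given as a type. As there is no type class of finite-dimensional normed spaces
  with arbitrary norm, the constant is defined for all real normed spaces; it is a specified value
  whenever the least element exists.\<close>

definition SS :: "'a::real_normed_vector itself \<Rightarrow> real" where
  "SS L = (LEAST t. t > 0 \<and> sign_sequence_bound L t)"

end

theory Submission
  imports Defs
begin

text \<open>
  Fix the vectors and consider the set of all sums \<open>\<plusminus>v\<^sub>1 \<plusminus> \<dots> \<plusminus> v\<^sub>k\<close> that can be formed without any
  prefix leaving the ball of radius \<open>t\<close>. It is symmetric about the origin, and \<open>t\<close> is admissible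
  iff this set never becomes empty.

  For \<open>t = \<surd>3\<close> in the plane, the set always contains two points \<open>a + b\<close> and \<open>a - b\<close> with \<open>a\<close> and
  \<open>b\<close> in the unit ball. Indeed, let \<open>v\<close> be the next vector. By symmetry all the sums
  \<open>\<plusminus>a \<plusminus> b \<plusminus> v\<close> are candidates for the next set, so that \<open>a\<close>, \<open>b\<close> and \<open>v\<close> now play the same role.
  Two of the lines spanned by these three vectors meet at an angle of at most 60 degrees, hence the
  sum or the difference \<open>w\<close> of two of the vectors lies in the unit ball
  (\<open>unit_ball_plane_short_combination\<close>). Let \<open>z\<close> be the third vector. If \<open>w + z\<close> and \<open>w - z\<close> both
  have norm at most \<open>\<surd>3\<close>, then they form the new pair. Otherwise one of them is longer than \<open>\<surd>3\<close>, and
  since their squared norms add up to at most 4, the other one has norm at most 1 and forms a new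
  pair together with itself (\<open>short_pair_survives\<close>).

  For \<open>t < \<surd>3\<close>, choose \<open>s\<close> between \<open>t\<close> and \<open>\<surd>3\<close>. Starting from a unit vector, the adversary
  ensures that the set is contained in some \<open>{p, -p}\<close>: if \<open>w\<close> is a unit vector with
  \<open>\<parallel>p - w\<parallel> = s\<close>, then \<open>p - w\<close> and its negative are too long, so the next set is contained in
  \<open>{p + w, -(p + w)}\<close>. By the parallelogram law
  \<open>\<parallel>p + w\<parallel>\<^sup>2 = 2\<parallel>p\<parallel>\<^sup>2 + 2 - s\<^sup>2\<close>, so each step doubles \<open>\<parallel>p\<parallel>\<^sup>2 - (s\<^sup>2 - 2)\<close>. This quantity starts at
  \<open>3 - s\<^sup>2 > 0\<close>, so \<open>p\<close> finally leaves the ball of radius \<open>t\<close>.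
\<close>

section \<open>Reachable signed sums\<close>

primrec reachable :: "real \<Rightarrow> (nat \<Rightarrow> 'a::real_normed_vector) \<Rightarrow> nat \<Rightarrow> 'a set" where
  "reachable t v 0 = {0}"
| "reachable t v (Suc k) =
     {y. norm y \<le> t \<and> (y - v (Suc k) \<in> reachable t v k \<or> y + v (Suc k) \<in> reachable t v k)}"

lemma reachable_uminus: "x \<in> reachable t v k \<Longrightarrow> - x \<in> reachable t v k"
proof (induction k arbitrary: x)
  case (Suc k)
  then have "- (x - v (Suc k)) \<in> reachable t v k \<or> - (x + v (Suc k)) \<in> reachable t v k"
    by fastforce
  then show ?case
    using Suc.prems by (auto simp: algebra_simps)
qed simp

lemma reachable_signed_sum_iff:
  "x \<in> reachable t v k \<longleftrightarrow>
     (\<exists>\<epsilon>. (\<forall>i\<in>{1..k}. \<epsilon> i \<in> {-1, 1::real}) \<and> x = (\<Sum>i=1..k. \<epsilon> i *\<^sub>R v i) \<and>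
          (\<forall>j\<in>{1..k}. norm (\<Sum>i=1..j. \<epsilon> i *\<^sub>R v i) \<le> t))"
  (is "_ \<longleftrightarrow> ?S k x")
proof (induction k arbitrary: x)
  case 0
  show ?case by simp
next
  case (Suc k)
  show ?case
  proof
    assume x: "x \<in> reachable t v (Suc k)"
    then obtain s :: real where s: "s \<in> {-1, 1}" "x - s *\<^sub>R v (Suc k) \<in> reachable t v k"
      by force
    then obtain \<epsilon> where \<epsilon>: "\<forall>i\<in>{1..k}. \<epsilon> i \<in> {-1, 1::real}"
      "x - s *\<^sub>R v (Suc k) = (\<Sum>i=1..k. \<epsilon> i *\<^sub>R v i)"
      "\<forall>j\<in>{1..k}. norm (\<Sum>i=1..j. \<epsilon> i *\<^sub>R v i) \<le> t"
      using Suc.IH by blast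
    define \<epsilon>' where "\<epsilon>' = \<epsilon>(Suc k := s)"
    have same: "(\<Sum>i=1..j. \<epsilon>' i *\<^sub>R v i) = (\<Sum>i=1..j. \<epsilon> i *\<^sub>R v i)" if "j \<le> k" for j
      using that by (intro sum.cong) (auto simp: \<epsilon>'_def)
    have x': "x = (\<Sum>i=1..Suc k. \<epsilon>' i *\<^sub>R v i)"
      using same[of k] \<epsilon>(2) by (simp add: \<epsilon>'_def algebra_simps)
    have "norm (\<Sum>i=1..j. \<epsilon>' i *\<^sub>R v i) \<le> t" if "j \<in> {1..Suc k}" for j
      using that same[of j] \<epsilon>(3) x x' by (cases "j = Suc k") auto
    moreover have "\<forall>i\<in>{1..Suc k}. \<epsilon>' i \<in> {-1, 1}"
      using \<epsilon>(1) s(1) by (auto simp: \<epsilon>'_def)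
    ultimately show "?S (Suc k) x"
      using x' by blast
  next
    assume "?S (Suc k) x"
    then obtain \<epsilon> where \<epsilon>: "\<forall>i\<in>{1..Suc k}. \<epsilon> i \<in> {-1, 1::real}"
      "x = (\<Sum>i=1..Suc k. \<epsilon> i *\<^sub>R v i)"
      "\<forall>j\<in>{1..Suc k}. norm (\<Sum>i=1..j. \<epsilon> i *\<^sub>R v i) \<le> t"
      by blast
    have "?S k (\<Sum>i=1..k. \<epsilon> i *\<^sub>R v i)"
      using \<epsilon>(1,3) by (intro exI[of _ \<epsilon>]) auto
    then have "(\<Sum>i=1..k. \<epsilon> i *\<^sub>R v i) \<in> reachable t v k"
      using Suc.IH by blast
    moreover have "norm x \<le> t"
      unfolding \<epsilon>(2) using \<epsilon>(3) by (rule bspec) simp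
    moreover have "\<epsilon> (Suc k) \<in> {-1, 1}"
      using \<epsilon>(1) by simp
    ultimately show "x \<in> reachable t v (Suc k)"
      using \<epsilon>(2) by auto
  qed
qed

lemma scaled_unit_cball:
  fixes x :: "'a::real_normed_vector"
  assumes "t > 0"
  shows "x \<in> (*\<^sub>R) t ` cball 0 1 \<longleftrightarrow> norm x \<le> t"
proof
  assume "norm x \<le> t"
  then have "x = t *\<^sub>R (x /\<^sub>R t)" "x /\<^sub>R t \<in> cball 0 1"
    using assms by (auto simp: field_simps)
  then show "x \<in> (*\<^sub>R) t ` cball 0 1"
    by blast
qed (use assms in auto)

lemma sign_sequence_bound_iff_reachable:
  assumes "t > 0"
  shows "sign_sequence_bound TYPE('a::real_normed_vector) t \<longleftrightarrow>
     (\<forall>n (v :: nat \<Rightarrow> 'a). (\<forall>i\<in>{1..n}. norm (v i) \<le> 1) \<longrightarrow> reachable t v n \<noteq> {})"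
  unfolding sign_sequence_bound_def scaled_unit_cball[OF assms] ex_in_conv[symmetric]
    reachable_signed_sum_iff by (simp add: Bex_def)

section \<open>The radius \<open>\<surd>3\<close> suffices in the plane\<close>

text \<open>The last hypothesis says that the lines spanned by \<open>x\<close> and \<open>y\<close> meet at an angle of at most 60
  degrees. In a triangle, a side opposite to such an angle is never longer than both other sides.\<close>

lemma short_combination_if_small_angle:
  fixes x y :: "'a::real_inner"
  assumes "norm x \<le> 1" "norm y \<le> 1" "norm x * norm y \<le> 2 * \<bar>x \<bullet> y\<bar>"
  shows "norm (x + y) \<le> 1 \<or> norm (x - y) \<le> 1"
proof -
  define X Y where "X = norm x" and "Y = norm y"
  have XY: "0 \<le> X" "X \<le> 1" "0 \<le> Y" "Y \<le> 1"
    using assms by (auto simp: X_def Y_def)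
  have bound: "X\<^sup>2 + Y\<^sup>2 - X * Y \<le> 1"
  proof (cases "X \<le> Y")
    case True
    then have "X * (Y - X) \<ge> 0" "Y\<^sup>2 \<le> 1"
      using XY by (auto simp: power_le_one)
    then show ?thesis by (simp add: power2_eq_square algebra_simps)
  next
    case False
    then have "Y * (X - Y) \<ge> 0" "X\<^sup>2 \<le> 1"
      using XY by (auto simp: power_le_one)
    then show ?thesis by (simp add: power2_eq_square algebra_simps)
  qed
  have "(norm (x + y))\<^sup>2 = X\<^sup>2 + Y\<^sup>2 + 2 * (x \<bullet> y)" "(norm (x - y))\<^sup>2 = X\<^sup>2 + Y\<^sup>2 - 2 * (x \<bullet> y)"
    by (simp_all add: X_def Y_def power2_norm_eq_inner inner_commute algebra_simps)
  then have "(norm (x + y))\<^sup>2 \<le> 1 \<or> (norm (x - y))\<^sup>2 \<le> 1"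
    using bound assms(3) unfolding X_def[symmetric] Y_def[symmetric] by linarith
  then show ?thesis
    by (simp add: abs_square_le_1)
qed

text \<open>Three vectors in the plane are linearly dependent, so their Gram determinant vanishes. If all
  angles between the lines exceeded 60 degrees, then the off-diagonal entries would be too small for
  that.\<close>

lemma plane_small_angle:
  fixes x y z :: "real ^ 2"
  shows "norm x * norm y \<le> 2 * \<bar>x \<bullet> y\<bar> \<or> norm x * norm z \<le> 2 * \<bar>x \<bullet> z\<bar> \<or>
         norm y * norm z \<le> 2 * \<bar>y \<bullet> z\<bar>"
proof (rule ccontr)
  define X Y Z where "X = norm x" and "Y = norm y" and "Z = norm z"
  define p q r where "p = x \<bullet> y" and "q = x \<bullet> z" and "r = y \<bullet> z"
  assume "\<not> ?thesis"
  then have less: "2 * \<bar>p\<bar> < X * Y" "2 * \<bar>q\<bar> < X * Z" "2 * \<bar>r\<bar> < Y * Z"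
    by (auto simp: X_def Y_def Z_def p_def q_def r_def)
  then have "X \<noteq> 0" "Y \<noteq> 0" "Z \<noteq> 0"
    by auto
  then have pos: "X > 0" "Y > 0" "Z > 0"
    by (auto simp: X_def Y_def Z_def)
  have gram: "X\<^sup>2 * Y\<^sup>2 * Z\<^sup>2 + 2 * (p * q * r) = X\<^sup>2 * r\<^sup>2 + Y\<^sup>2 * q\<^sup>2 + Z\<^sup>2 * p\<^sup>2"
    unfolding X_def Y_def Z_def p_def q_def r_def power2_norm_eq_inner
    by (simp add: inner_vec_def UNIV_2 power2_eq_square algebra_simps)
  have sq: "(2 * p)\<^sup>2 < X\<^sup>2 * Y\<^sup>2" "(2 * q)\<^sup>2 < X\<^sup>2 * Z\<^sup>2" "(2 * r)\<^sup>2 < Y\<^sup>2 * Z\<^sup>2"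
    using less[THEN power_strict_mono[where n = 2]] by (simp_all add: power_mult_distrib)
  have "4 * (Z\<^sup>2 * p\<^sup>2) < X\<^sup>2 * Y\<^sup>2 * Z\<^sup>2"
    using mult_strict_left_mono[OF sq(1), of "Z\<^sup>2"] pos by (simp add: algebra_simps)
  moreover have "4 * (Y\<^sup>2 * q\<^sup>2) < X\<^sup>2 * Y\<^sup>2 * Z\<^sup>2"
    using mult_strict_left_mono[OF sq(2), of "Y\<^sup>2"] pos by (simp add: algebra_simps)
  moreover have "4 * (X\<^sup>2 * r\<^sup>2) < X\<^sup>2 * Y\<^sup>2 * Z\<^sup>2"
    using mult_strict_left_mono[OF sq(3), of "X\<^sup>2"] pos by (simp add: algebra_simps)
  moreover have "8 * \<bar>p * q * r\<bar> \<le> X\<^sup>2 * Y\<^sup>2 * Z\<^sup>2"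
  proof -
    have "(2 * \<bar>p\<bar>) * (2 * \<bar>q\<bar>) * (2 * \<bar>r\<bar>) \<le> (X * Y) * (X * Z) * (Y * Z)"
      by (rule mult_mono[OF mult_mono]) (use less pos in auto)
    then show ?thesis
      by (simp add: abs_mult power2_eq_square algebra_simps)
  qed
  ultimately show False
    using gram by linarith
qed

lemma unit_ball_plane_short_combination:
  fixes x y z :: "real ^ 2"
  assumes "norm x \<le> 1" "norm y \<le> 1" "norm z \<le> 1"
  obtains "norm (x + y) \<le> 1" | "norm (x - y) \<le> 1" | "norm (x + z) \<le> 1" | "norm (x - z) \<le> 1"
    | "norm (y + z) \<le> 1" | "norm (y - z) \<le> 1"
  using assms plane_small_angle[of x y z] short_combination_if_small_angle by blast

lemma parallelogram_law:
  fixes x y :: "'a::real_inner"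
  shows "(norm (x + y))\<^sup>2 + (norm (x - y))\<^sup>2 = 2 * (norm x)\<^sup>2 + 2 * (norm y)\<^sup>2"
  by (simp add: power2_norm_eq_inner algebra_simps)

text \<open>This is where the radius \<open>\<surd>3\<close> comes from: by the parallelogram law, a point \<open>w \<plusminus> z\<close> outside the
  ball of this radius forces its partner into the unit ball.\<close>

lemma short_pair_survives:
  fixes w z :: "'a::real_inner"
  assumes "norm w \<le> 1" "norm z \<le> 1"
  obtains a b where "norm a \<le> 1" "norm b \<le> 1"
    "{a + b, a - b} \<subseteq> {w + z, w - z} \<inter> cball 0 (sqrt 3)"
proof -
  have sum: "(norm (w + z))\<^sup>2 + (norm (w - z))\<^sup>2 \<le> 4"
    using assms power_le_one[of "norm w" 2] power_le_one[of "norm z" 2]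
    by (simp add: parallelogram_law)
  have outside: "(norm y)\<^sup>2 > 3" if "\<not> norm y \<le> sqrt 3" for y :: 'a
    using that real_le_rsqrt by (meson not_le)
  have inside: "norm y \<le> 1" if "(norm y)\<^sup>2 \<le> 1" for y :: 'a
    using that by (simp add: abs_square_le_1)
  have sqrt3: "1 \<le> sqrt (3::real)"
    by simp
  consider "norm (w + z) \<le> sqrt 3" "norm (w - z) \<le> sqrt 3"
    | "norm (w + z) \<le> 1" | "norm (w - z) \<le> 1"
  proof -
    assume cases: "norm (w + z) \<le> sqrt 3 \<Longrightarrow> norm (w - z) \<le> sqrt 3 \<Longrightarrow> thesis"
      "norm (w + z) \<le> 1 \<Longrightarrow> thesis" "norm (w - z) \<le> 1 \<Longrightarrow> thesis"
    have "norm (w - z) \<le> 1" if "\<not> norm (w + z) \<le> sqrt 3"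
      using outside[OF that] sum by (intro inside) linarith
    moreover have "norm (w + z) \<le> 1" if "\<not> norm (w - z) \<le> sqrt 3"
      using outside[OF that] sum by (intro inside) linarith
    ultimately show thesis
      using cases by blast
  qed
  then show thesis
  proof cases
    case 1
    then show ?thesis using that[of w z] assms by simp
  next
    case 2
    then show ?thesis using that[of "w + z" 0] sqrt3 by simp
  next
    case 3
    then show ?thesis using that[of "w - z" 0] sqrt3 by simp
  qed
qed

text \<open>A single point of the unit ball would be too strong an invariant: after two orthogonal unit
  vectors, all four signed sums have norm \<open>\<surd>2\<close>. Pairs \<open>a \<plusminus> b\<close> work because in the next step the new
  vector is exchangeable with \<open>a\<close> and \<open>b\<close>.\<close>

lemma reachable_short_pair:
  fixes v :: "nat \<Rightarrow> real ^ 2"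
  assumes "\<forall>i\<in>{1..n}. norm (v i) \<le> 1"
  shows "\<exists>a b. norm a \<le> 1 \<and> norm b \<le> 1 \<and> {a + b, a - b} \<subseteq> reachable (sqrt 3) v n"
  using assms
proof (induction n)
  case 0
  show ?case
    by (intro exI[of _ 0]) simp
next
  case (Suc n)
  define u where "u = v (Suc n)"
  define Q where "Q = {y. y - u \<in> reachable (sqrt 3) v n \<or> y + u \<in> reachable (sqrt 3) v n}"
  obtain a b where ab: "norm a \<le> 1" "norm b \<le> 1" "a + b \<in> reachable (sqrt 3) v n"
    "a - b \<in> reachable (sqrt 3) v n"
    using Suc by auto
  moreover have "- a - b \<in> reachable (sqrt 3) v n" "b - a \<in> reachable (sqrt 3) v n"
    using ab(3,4)[THEN reachable_uminus] by (simp_all add: algebra_simps)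
  ultimately have Q: "a + b + u \<in> Q" "a + b - u \<in> Q" "a - b + u \<in> Q" "a - b - u \<in> Q"
    "b - a + u \<in> Q" "b - a - u \<in> Q"
    by (auto simp: Q_def)
  have u: "norm u \<le> 1"
    using Suc.prems by (simp add: u_def)
  have "\<exists>w z. norm w \<le> 1 \<and> norm z \<le> 1 \<and> w + z \<in> Q \<and> w - z \<in> Q"
    using ab(1,2) u
  proof (cases rule: unit_ball_plane_short_combination)
    case 1
    then show ?thesis using Q u by (intro exI[of _ "a + b"] exI[of _ u]) simp
  next
    case 2
    then show ?thesis using Q u by (intro exI[of _ "a - b"] exI[of _ u]) simp
  next
    case 3
    then show ?thesis using Q ab by (intro exI[of _ "a + u"] exI[of _ b]) (simp add: algebra_simps)
  next
    case 4
    then show ?thesis using Q ab by (intro exI[of _ "a - u"] exI[of _ b]) (simp add: algebra_simps)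
  next
    case 5
    then show ?thesis using Q ab by (intro exI[of _ "b + u"] exI[of _ a]) (simp add: algebra_simps)
  next
    case 6
    then show ?thesis using Q ab by (intro exI[of _ "b - u"] exI[of _ a]) (simp add: algebra_simps)
  qed
  then obtain w z where wz: "norm w \<le> 1" "norm z \<le> 1" "w + z \<in> Q" "w - z \<in> Q"
    by blast
  obtain a' b' where ab': "norm a' \<le> 1" "norm b' \<le> 1"
    "{a' + b', a' - b'} \<subseteq> {w + z, w - z} \<inter> cball 0 (sqrt 3)"
    using short_pair_survives[OF wz(1,2)] .
  note ab'(3)
  also have "{w + z, w - z} \<inter> cball 0 (sqrt 3) \<subseteq> Q \<inter> cball 0 (sqrt 3)"
    using wz(3,4) by blast
  also have "\<dots> \<subseteq> reachable (sqrt 3) v (Suc n)"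
    by (auto simp: Q_def u_def)
  finally show ?case
    using ab'(1,2) by (intro exI[of _ a'] exI[of _ b'] conjI)
qed

section \<open>No smaller radius suffices in dimension at least two\<close>

text \<open>The vector \<open>w\<close> is found in a plane through \<open>p\<close>: its component along \<open>p\<close> is dictated by the norm
  of \<open>p - w\<close>, and it fits into the unit ball because of the triangle inequalities between the side
  lengths \<open>\<parallel>p\<parallel>\<close>, \<open>1\<close> and \<open>s\<close>.\<close>

lemma unit_vector_at_distance:
  fixes p :: "'a::euclidean_space"
  assumes "2 \<le> DIM('a)" "1 \<le> norm p" "norm p \<le> s" "s \<le> 2"
  shows "\<exists>w. norm w = 1 \<and> norm (p - w) = s"
proof -
  obtain y where "y \<noteq> 0" "orthogonal p y"
    using orthogonal_to_vector_exists[OF assms(1)] by blast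
  then have y: "sgn y \<bullet> sgn y = 1" "p \<bullet> sgn y = 0"
    by (auto simp: sgn_div_norm orthogonal_def power2_norm_eq_inner[symmetric] power2_eq_square
        field_simps simp flip: power2_norm_eq_inner)
  define r where "r = norm p"
  define c where "c = (r\<^sup>2 + 1 - s\<^sup>2) / (2 * r)"
  have r: "1 \<le> r" "r \<le> s" "p \<bullet> p = r\<^sup>2"
    using assms by (auto simp: r_def power2_norm_eq_inner)
  have "(r - 1)\<^sup>2 \<le> s\<^sup>2" "s\<^sup>2 \<le> (r + 1)\<^sup>2"
    using r assms(4) by (auto intro!: power_mono)
  then have "\<bar>r\<^sup>2 + 1 - s\<^sup>2\<bar> \<le> 2 * r"
    by (simp add: power2_eq_square algebra_simps abs_le_iff)
  then have "\<bar>c\<bar> \<le> 1"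
    using r by (simp add: c_def abs_divide)
  then have c1: "c\<^sup>2 \<le> 1"
    by (simp add: abs_square_le_1)
  define w where "w = (c / r) *\<^sub>R p + sqrt (1 - c\<^sup>2) *\<^sub>R sgn y"
  have pw: "p \<bullet> w = c * r"
    using y r by (simp add: w_def inner_add_right power2_eq_square)
  have ww: "w \<bullet> w = 1"
  proof -
    have "w \<bullet> w = (c / r)\<^sup>2 * r\<^sup>2 + (sqrt (1 - c\<^sup>2))\<^sup>2"
      using y r by (simp add: w_def inner_add_right inner_add_left inner_commute power2_eq_square)
    then show ?thesis
      using r c1 by (simp add: power_divide)
  qed
  have "(p - w) \<bullet> (p - w) = s\<^sup>2"
  proof -
    have "c * (2 * r) = r\<^sup>2 + 1 - s\<^sup>2"
      using r by (simp add: c_def)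
    then show ?thesis
      using pw ww r by (simp add: inner_diff_left inner_diff_right inner_commute)
  qed
  then show ?thesis
    using ww r by (intro exI[of _ w]) (simp add: norm_eq_sqrt_inner)
qed

lemma sign_sequence_bound_ge_sqrt3:
  assumes dim: "2 \<le> DIM('a::euclidean_space)"
    and t: "t > 0" "sign_sequence_bound TYPE('a) t"
  shows "sqrt 3 \<le> t"
proof (rule ccontr)
  assume "\<not> sqrt 3 \<le> t"
  then obtain s where s: "max t 1 < s" "s < sqrt 3"
    using dense[of "max t 1" "sqrt 3"] by auto
  then have "s\<^sup>2 < (sqrt 3)\<^sup>2"
    by (intro power_strict_mono) auto
  then have s2: "s\<^sup>2 < 3"
    by simp
  then have "s\<^sup>2 \<le> 2\<^sup>2"
    by simp
  then have "s \<le> 2"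
    by (rule power2_le_imp_le) simp
  \<comment> \<open>The vectors have to be admissible even where the distance \<open>s\<close> cannot be attained, hence the
    total version.\<close>
  have "\<exists>w. norm w \<le> 1 \<and> (1 \<le> norm p \<and> norm p \<le> s \<longrightarrow> norm w = 1 \<and> norm (p - w) = s)" for p :: 'a
  proof (cases "1 \<le> norm p \<and> norm p \<le> s")
    case True
    then show ?thesis
      using unit_vector_at_distance[OF dim _ _ \<open>s \<le> 2\<close>, of p] by (metis order_refl)
  next
    case False
    then show ?thesis
      by (intro exI[of _ 0]) auto
  qed
  then obtain W :: "'a \<Rightarrow> 'a" where W: "\<And>p. norm (W p) \<le> 1"
    "\<And>p. 1 \<le> norm p \<Longrightarrow> norm p \<le> s \<Longrightarrow> norm (W p) = 1 \<and> norm (p - W p) = s"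
    by metis
  obtain e :: 'a where e: "norm e = 1"
    using vector_choose_size[of 1] by auto
  define p where "p = rec_nat e (\<lambda>_ x. x + W x)"
  have p: "p 0 = e" "p (Suc k) = p k + W (p k)" for k
    by (simp_all add: p_def)
  define v where "v i = (if i = 1 then e else W (p (i - 2)))" for i
  have v: "v (Suc 0) = e" "v (Suc (Suc k)) = W (p k)" for k
    by (simp_all add: v_def)
  have nonempty: "reachable t v n \<noteq> {}" for n
    using t sign_sequence_bound_iff_reachable[OF t(1), where 'a = 'a] e W(1) by (auto simp: v_def)
  \<comment> \<open>The constant lower bound keeps the norm of \<open>p k\<close> at least 1, which is necessary for the
    existence of the next vector at distance \<open>s\<close>; the exponential one yields the contradiction.\<close>
  have grow: "reachable t v (Suc k) \<subseteq> {p k, - p k} \<and> 3 - s\<^sup>2 \<le> (norm (p k))\<^sup>2 - (s\<^sup>2 - 2) \<and>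
     2 ^ k * (3 - s\<^sup>2) \<le> (norm (p k))\<^sup>2 - (s\<^sup>2 - 2)" for k
  proof (induction k)
    case 0
    have "y = e \<or> y = - e" if "y - e = 0 \<or> y + e = 0" for y
      using that by (simp add: eq_neg_iff_add_eq_0)
    then show ?case
      using e by (auto simp: v p)
  next
    case (Suc k)
    have "norm (p k) \<le> t"
    proof -
      obtain y where y: "y \<in> reachable t v (Suc k)"
        using nonempty by blast
      then have "norm y \<le> t" by simp
      then show ?thesis using y Suc by auto
    qed
    then have le: "norm (p k) \<le> s"
      using s by simp
    have "1 \<le> (norm (p k))\<^sup>2"
      using Suc s2 by simp
    then have ge: "1 \<le> norm (p k)"
      by (intro power2_le_imp_le[of 1]) auto
    have far: "norm (W (p k)) = 1" "norm (p k - W (p k)) = s"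
      using W(2)[OF ge le] by auto
    have "reachable t v (Suc (Suc k)) \<subseteq> {p (Suc k), - p (Suc k)}"
    proof
      fix y assume y: "y \<in> reachable t v (Suc (Suc k))"
      then have "norm y \<le> t" by simp
      then have "norm y \<noteq> s" using s by simp
      then have "y \<noteq> p k - W (p k)" "y \<noteq> - (p k - W (p k))"
        using far(2) by (auto simp: norm_minus_commute)
      moreover have "y - W (p k) \<in> {p k, - p k} \<or> y + W (p k) \<in> {p k, - p k}"
        using y conjunct1[OF Suc] unfolding reachable.simps(2)[of t v "Suc k"] v(2) by blast
      ultimately show "y \<in> {p (Suc k), - p (Suc k)}"
        by (auto simp: p algebra_simps)
    qed
    moreover have "(norm (p (Suc k)))\<^sup>2 - (s\<^sup>2 - 2) = 2 * ((norm (p k))\<^sup>2 - (s\<^sup>2 - 2))"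
      using parallelogram_law[of "p k" "W (p k)"] far by (simp add: p)
    ultimately show ?case
      using Suc s2 by auto
  qed
  obtain k where "(4 - s\<^sup>2 + t\<^sup>2) / (3 - s\<^sup>2) < 2 ^ k"
    using real_arch_pow[of 2] by auto
  then have "4 - s\<^sup>2 + t\<^sup>2 < 2 ^ k * (3 - s\<^sup>2)"
    using s2 by (simp add: field_simps)
  then have "t\<^sup>2 < (norm (p k))\<^sup>2"
    using grow[of k] by linarith
  then have "t < norm (p k)"
    by (rule power_less_imp_less_base) simp
  moreover obtain y where "y \<in> reachable t v (Suc k)"
    using nonempty by blast
  ultimately show False
    using grow[of k] by fastforce
qed

theorem theorem1p2: "SS TYPE(real ^ 2) = sqrt 3"
  unfolding SS_def
proof (rule Least_equality)
  have "sign_sequence_bound TYPE(real ^ 2) (sqrt 3)"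
  proof (subst sign_sequence_bound_iff_reachable, simp, intro allI impI)
    fix n and v :: "nat \<Rightarrow> real ^ 2"
    assume "\<forall>i\<in>{1..n}. norm (v i) \<le> 1"
    from reachable_short_pair[OF this] show "reachable (sqrt 3) v n \<noteq> {}"
      by blast
  qed
  then show "sqrt 3 > 0 \<and> sign_sequence_bound TYPE(real ^ 2) (sqrt 3)"
    by simp
next
  fix t assume "t > 0 \<and> sign_sequence_bound TYPE(real ^ 2) t"
  then show "sqrt 3 \<le> t"
    using sign_sequence_bound_ge_sqrt3[where 'a = "real ^ 2"] by simp
qed

end
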